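(* Let $\mathbb K$ be a commutative unital ring, $V,W$ $\mathbb K$-modules, $U\subset V$, $f:U\to W$ a map, $n\ge 1$, and let $\mathbf t=(t_1,\dots,t_n)\in(\mathbb K^\times)^n$ be invertible scalars. Then for every $\mathbf v=(v_\alpha)_{\alpha\in\mathcal P(\{1,\dots,n\})}\in U^{[n]}_{\mathbf t}$ (with $v_\alpha\in V$), $$f^{[n]}_{\mathbf t}(\mathbf v)=\frac{1}{\prod_{i=1}^n t_i}\sum_{\alpha\in\mathcal P(\{1,\dots,n\})}(-1)^{n-|\alpha|}\, f\Bigl(\sum_{\beta\subset\alpha}\bigl(\textstyle\prod_{i\in\beta}t_i\bigr)\,v_\beta\Bigr).$$
   Context: For a subset $U$ of a $\mathbb K$-module $V$, a map $f:U\to W$ and an invertible scalar $t$, put $U_t=\{(v_0,v_1)\in V^2: v_0\in U,\ v_0+tv_1\in U\}$ and $f^{[1]}_t:U_t\to W$, $f^{[1]}_t(v_0,v_1)=\frac{1}{t}\bigl(f(v_0+tv_1)-f(v_0)\bigr)$. Recursively, for $\mathbf t=(t_1,\dots,t_n)$, $U^{[n]}_{\mathbf t}=(\dots(U_{t_1})_{t_2}\dots)_{t_n}$ and $f^{[n]}_{\mathbf t}=\bigl(f^{[n-1]}_{t_1,\dots,t_{n-1}}\bigr)^{[1]}_{t_n}:U^{[n]}_{\mathbf t}\to W$. Elements of $U^{[n]}_{\mathbf t}\subset V^{2^n}$ are indexed by subsets of $\{1,\dots,n\}$ as follows: an element of $U^{[n]}_{\mathbf t}=(U^{[n-1]}_{(t_1,\dots,t_{n-1})})_{t_n}$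 is a pair $(x,y)$ with $x=(v_\alpha)_{\alpha\subset\{1,\dots,n-1\}}$ and $y=(v_{\alpha\cup\{n\}})_{\alpha\subset\{1,\dots,n-1\}}$. The empty product is $1$. *)

theory Defs
  imports "HOL-Algebra.Module"
begin

text \<open>The power module of families \<open>(v\<^sub>i)\<close> with \<open>i \<in> I\<close>, represented by extensional functions.
  The fields \<open>mult\<close> and \<open>one\<close> play no role for modules, but the record type requires them.\<close>

definition power_module ::
  "'i set \<Rightarrow> ('k, 'v, 'm) module_scheme \<Rightarrow> ('k, 'i \<Rightarrow> 'v) module" where
  "power_module I V =
    \<lparr>carrier = I \<rightarrow>\<^sub>E carrier V,
     mult = (\<lambda>x y. \<lambda>i\<in>I. x i \<otimes>\<^bsub>V\<^esub> y i),
     one = (\<lambda>i\<in>I. \<one>\<^bsub>V\<^esub>),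
     zero = (\<lambda>i\<in>I. \<zero>\<^bsub>V\<^esub>),
     add = (\<lambda>x y. \<lambda>i\<in>I. x i \<oplus>\<^bsub>V\<^esub> y i),
     smult = (\<lambda>c x. \<lambda>i\<in>I. c \<odot>\<^bsub>V\<^esub> x i)\<rparr>"

lemma module_power_module:
  assumes "module K V"
  shows "module K (power_module I V)"
proof -
  interpret module K V by fact
  show ?thesis
  proof (intro module.intro abelian_groupI module_axioms.intro R.is_cring)
    fix x assume x: "x \<in> carrier (power_module I V)"
    show "\<exists>y\<in>carrier (power_module I V).
        y \<oplus>\<^bsub>power_module I V\<^esub> x = \<zero>\<^bsub>power_module I V\<^esub>"
      using x by (intro bexI[of _ "\<lambda>i\<in>I. \<ominus>\<^bsub>V\<^esub> x i"])
        (auto simp: power_module_def PiE_iff M.l_neg intro!: ext)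
  qed (auto simp: power_module_def PiE_iff extensional_def fun_eq_iff
      M.a_ac smult_l_distr smult_r_distr smult_assoc1)
qed

text \<open>The set \<open>U\<^sub>t\<close> and the map \<open>f\<^sub>t\<^bsup>[1]\<^esup>\<close>, for a subset \<open>U\<close> of an arbitrary module \<open>V\<close>.\<close>

definition quot_dom ::
  "('k, 'v, 'm) module_scheme \<Rightarrow> 'v set \<Rightarrow> 'k \<Rightarrow> ('v \<times> 'v) set" where
  "quot_dom V U t =
    {(v0, v1) \<in> carrier V \<times> carrier V. v0 \<in> U \<and> v0 \<oplus>\<^bsub>V\<^esub> t \<odot>\<^bsub>V\<^esub> v1 \<in> U}"

definition quot_map ::
  "('k, 'r) ring_scheme \<Rightarrow> ('k, 'v, 'm) module_scheme \<Rightarrow> ('k, 'w, 'n) module_scheme \<Rightarrow>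
   ('v \<Rightarrow> 'w) \<Rightarrow> 'k \<Rightarrow> 'v \<times> 'v \<Rightarrow> 'w" where
  "quot_map K V W f t =
    (\<lambda>(v0, v1). inv\<^bsub>K\<^esub> t \<odot>\<^bsub>W\<^esub> (f (v0 \<oplus>\<^bsub>V\<^esub> t \<odot>\<^bsub>V\<^esub> v1) \<ominus>\<^bsub>W\<^esub> f v0))"

text \<open>Elements of \<open>V\<close> to the power \<open>2\<^sup>n\<close> are families indexed by the subsets of \<open>{1..n}\<close>.\<close>

abbreviation cube_module ::
  "nat \<Rightarrow> ('k, 'v, 'm) module_scheme \<Rightarrow> ('k, nat set \<Rightarrow> 'v) module" where
  "cube_module n V \<equiv> power_module (Pow {1..n}) V"

text \<open>The identification of a family indexed by the subsets of \<open>{1..n+1}\<close> with a pair \<open>(x, y)\<close> of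
  families indexed by the subsets of \<open>{1..n}\<close>.\<close>

definition split_last :: "nat \<Rightarrow> (nat set \<Rightarrow> 'v) \<Rightarrow> (nat set \<Rightarrow> 'v) \<times> (nat set \<Rightarrow> 'v)" where
  "split_last n v = (\<lambda>\<alpha>\<in>Pow {1..n}. v \<alpha>, \<lambda>\<alpha>\<in>Pow {1..n}. v (\<alpha> \<union> {Suc n}))"

lemma bij_betw_split_last:
  "bij_betw (split_last n) (carrier (cube_module (Suc n) V))
     (carrier (cube_module n V) \<times> carrier (cube_module n V))"
proof (rule bij_betw_byWitness[where f' = "\<lambda>(x, y). \<lambda>\<alpha>\<in>Pow {1..Suc n}.
    if Suc n \<in> \<alpha> then y (\<alpha> - {Suc n}) else x \<alpha>"], goal_cases)
  case 1
  have *: "\<alpha> \<subseteq> {Suc 0..n}" if "\<alpha> \<subseteq> {Suc 0..Suc n}" "Suc n \<notin> \<alpha>" for \<alpha>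
    using that by (force simp: subset_iff le_Suc_eq)
  have **: "\<alpha> - {Suc n} \<subseteq> {Suc 0..n}" if "\<alpha> \<subseteq> {Suc 0..Suc n}" for \<alpha>
    using that by (force simp: subset_iff le_Suc_eq)
  show ?case
    by (auto simp: split_last_def power_module_def PiE_iff extensional_def fun_eq_iff
        insert_absorb * **)
next
  case 2
  have *: "\<alpha> - {Suc n} = \<alpha>" "Suc n \<notin> \<alpha>" if "\<alpha> \<subseteq> {Suc 0..n}" for \<alpha>
    using that by auto
  show ?case
    by (force simp: split_last_def power_module_def PiE_iff extensional_def fun_eq_iff * subset_iff)
next
  case 3
  show ?case
    by (force simp: split_last_def power_module_def PiE_iff)
next
  case 4
  have *: "\<alpha> \<subseteq> {Suc 0..n}" if "\<alpha> \<subseteq> {Suc 0..Suc n}" "Suc n \<notin> \<alpha>" for \<alpha>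
    using that by (force simp: subset_iff le_Suc_eq)
  have **: "\<alpha> - {Suc n} \<subseteq> {Suc 0..n}" if "\<alpha> \<subseteq> {Suc 0..Suc n}" for \<alpha>
    using that by (force simp: subset_iff le_Suc_eq)
  have "x \<alpha> \<in> carrier V" if "x \<in> carrier (cube_module n V)" "\<alpha> \<subseteq> {Suc 0..n}" for x \<alpha>
    using that by (auto simp: power_module_def PiE_iff)
  then show ?case
    using * ** by (fastforce simp: power_module_def restrict_PiE_iff)
qed

text \<open>The sets \<open>U\<^sub>t\<^bsup>[n]\<^esup>\<close> and the maps \<open>f\<^sub>t\<^bsup>[n]\<^esup>\<close>, where \<open>(t\<^sub>1, \<dots>, t\<^sub>n)\<close> is given by the values of
  \<open>t\<close> on \<open>{1..n}\<close>. In the base case, \<open>V\<close> is identified with the families indexed by \<open>{{}}\<close>.\<close>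

primrec iter_dom ::
  "('k, 'v, 'm) module_scheme \<Rightarrow> 'v set \<Rightarrow> (nat \<Rightarrow> 'k) \<Rightarrow> nat \<Rightarrow> (nat set \<Rightarrow> 'v) set" where
  "iter_dom V U t 0 = {v \<in> carrier (cube_module 0 V). v {} \<in> U}"
| "iter_dom V U t (Suc n) =
    {v \<in> carrier (cube_module (Suc n) V).
       split_last n v \<in> quot_dom (cube_module n V) (iter_dom V U t n) (t (Suc n))}"

primrec iter_map ::
  "('k, 'r) ring_scheme \<Rightarrow> ('k, 'v, 'm) module_scheme \<Rightarrow> ('k, 'w, 'n) module_scheme \<Rightarrow>
   ('v \<Rightarrow> 'w) \<Rightarrow> (nat \<Rightarrow> 'k) \<Rightarrow> nat \<Rightarrow> (nat set \<Rightarrow> 'v) \<Rightarrow> 'w" where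
  "iter_map K V W f t 0 = (\<lambda>v. f (v {}))"
| "iter_map K V W f t (Suc n) =
    (\<lambda>v. quot_map K (cube_module n V) W (iter_map K V W f t n) (t (Suc n)) (split_last n v))"

end

theory Submission
  imports Defs
begin

text \<open>Induction on \<open>n\<close>. The corner of the cube \<open>v\<close> at \<open>\<alpha>\<close> is \<open>\<Sum>\<^bsub>\<beta> \<subseteq> \<alpha>\<^esub> (\<Prod>\<^bsub>i \<in> \<beta>\<^esub> t\<^sub>i) v\<^sub>\<beta>\<close>.
  If \<open>v\<close> is identified with \<open>(x, y)\<close>, then its corners at the subsets of \<open>{1..n}\<close> are those of \<open>x\<close>,
  and its corner at \<open>\<alpha> \<union> {n+1}\<close> is the corner of \<open>x + t\<^bsub>n+1\<^esub> y\<close> at \<open>\<alpha>\<close>. So the formula for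
  \<open>n + 1\<close> is the difference of the formulas for \<open>x + t\<^bsub>n+1\<^esub> y\<close> and \<open>x\<close>, divided by
  \<open>t\<^bsub>n+1\<^esub>\<close>.\<close>

section \<open>Units, and sums over power sets\<close>

lemma (in comm_monoid) finprod_Units_closed:
  "f \<in> A \<rightarrow> Units G \<Longrightarrow> (\<Otimes>i\<in>A. f i) \<in> Units G"
\<comment> \<open>No finiteness of \<open>A\<close> is assumed: a product over an infinite set is
  one by convention, hence a unit.\<close>
proof (induction A rule: infinite_finite_induct)
  case (insert a A)
  then have "(\<Otimes>i\<in>insert a A. f i) = f a \<otimes> (\<Otimes>i\<in>A. f i)"
    by (intro finprod_insert) auto
  then show ?case
    using insert by auto
qed auto

lemma (in comm_monoid) inv_mult_Units:
  assumes "x \<in> Units G" "y \<in> Units G"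
  shows "inv (x \<otimes> y) = inv x \<otimes> inv y"
proof (rule comm_inv_char)
  have "(x \<otimes> y) \<otimes> (inv x \<otimes> inv y) = (x \<otimes> inv x) \<otimes> (y \<otimes> inv y)"
    using assms[THEN Units_closed] assms[THEN Units_inv_closed]
    by (simp add: m_ac del: Units_r_inv Units_l_inv)
  also have "\<dots> = \<one>"
    using assms by simp
  finally show "(x \<otimes> y) \<otimes> (inv x \<otimes> inv y) = \<one>" .
qed (use assms in auto)

text \<open>The subsets containing \<open>a\<close> are the image of \<open>Pow A\<close> under
  \<open>insert a\<close>, which is injective there because \<open>a \<notin> A\<close>. This
  splitting drives the recursion both for corners and for alternating sums.\<close>

lemma (in abelian_monoid) finsum_Pow_insert:
  assumes "finite A" "a \<notin> A" "g \<in> Pow (insert a A) \<rightarrow> carrier G"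
  shows "(\<Oplus>\<alpha>\<in>Pow (insert a A). g \<alpha>) =
    (\<Oplus>\<alpha>\<in>Pow A. g \<alpha>) \<oplus> (\<Oplus>\<alpha>\<in>Pow A. g (insert a \<alpha>))"
proof -
  have inj: "inj_on (insert a) (Pow A)"
    using assms(2) by (auto simp: inj_on_def)
  have "(\<Oplus>\<alpha>\<in>Pow (insert a A). g \<alpha>) =
      (\<Oplus>\<alpha>\<in>Pow A. g \<alpha>) \<oplus> (\<Oplus>\<alpha>\<in>insert a ` Pow A. g \<alpha>)"
    unfolding Pow_insert using assms by (intro finsum_Un_disjoint) (auto simp: Pi_iff)
  also have "(\<Oplus>\<alpha>\<in>insert a ` Pow A. g \<alpha>) = (\<Oplus>\<alpha>\<in>Pow A. g (insert a \<alpha>))"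
    using assms(3) by (intro finsum_reindex inj) (auto simp: Pi_iff)
  finally show ?thesis .
qed

section \<open>Corners of a cube\<close>

definition cube_corner ::
  "('k, 'r) ring_scheme \<Rightarrow> ('k, 'v, 'm) module_scheme \<Rightarrow> (nat \<Rightarrow> 'k) \<Rightarrow>
   (nat set \<Rightarrow> 'v) \<Rightarrow> nat set \<Rightarrow> 'v" where
  "cube_corner K V t v \<alpha> = (\<Oplus>\<^bsub>V\<^esub>\<beta>\<in>Pow \<alpha>. (\<Otimes>\<^bsub>K\<^esub>i\<in>\<beta>. t i) \<odot>\<^bsub>V\<^esub> v \<beta>)"

lemma cube_module_closed:
  "v \<in> carrier (cube_module n V) \<Longrightarrow> \<alpha> \<subseteq> {1..n} \<Longrightarrow> v \<alpha> \<in> carrier V"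
  by (auto simp: power_module_def)

context module
begin

text \<open>Agreement is required only on subsets of \<alpha>, because the families to be compared
  come from restrictions and differ elsewhere.\<close>

lemma cube_corner_cong:
  assumes "finite \<alpha>" "t \<in> \<alpha> \<rightarrow> carrier R"
    and "\<And>\<beta>. \<beta> \<subseteq> \<alpha> \<Longrightarrow> w \<beta> \<in> carrier M" "\<And>\<beta>. \<beta> \<subseteq> \<alpha> \<Longrightarrow> v \<beta> = w \<beta>"
  shows "cube_corner R M t v \<alpha> = cube_corner R M t w \<alpha>"
  unfolding cube_corner_def
proof (rule M.finsum_cong')
  show "(\<lambda>\<beta>. (\<Otimes>i\<in>\<beta>. t i) \<odot>\<^bsub>M\<^esub> w \<beta>) \<in> Pow \<alpha> \<rightarrow> carrier M"
    using assms by (auto intro!: smult_closed R.finprod_closed)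
qed (use assms in auto)

text \<open>Pair each \<beta> not containing \<open>a\<close> with \<open>insert a \<beta>\<close>.
  The product over \<open>insert a \<beta>\<close> is that over \<beta> times \<open>t a\<close>, so
  the product over \<beta> is a common factor of the two terms.\<close>

lemma cube_corner_insert:
  assumes fin: "finite \<alpha>" and a: "a \<notin> \<alpha>" and t: "t \<in> insert a \<alpha> \<rightarrow> carrier R"
    and v: "\<And>\<beta>. \<beta> \<subseteq> insert a \<alpha> \<Longrightarrow> v \<beta> \<in> carrier M"
  shows "cube_corner R M t v (insert a \<alpha>) =
    cube_corner R M t (\<lambda>\<beta>. v \<beta> \<oplus>\<^bsub>M\<^esub> t a \<odot>\<^bsub>M\<^esub> v (insert a \<beta>)) \<alpha>"
proof -
  define P where "P \<beta> = (\<Otimes>i\<in>\<beta>. t i)" for \<beta>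
  have P: "P \<beta> \<in> carrier R" if "\<beta> \<subseteq> insert a \<alpha>" for \<beta>
    unfolding P_def using that t by (auto intro!: R.finprod_closed)
  have Pins: "P (insert a \<beta>) = P \<beta> \<otimes> t a" if "\<beta> \<subseteq> \<alpha>" for \<beta>
  proof -
    have "P (insert a \<beta>) = t a \<otimes> P \<beta>"
      unfolding P_def using that a t finite_subset[OF that fin]
      by (intro R.finprod_insert) auto
    moreover have "P \<beta> \<in> carrier R" "t a \<in> carrier R"
      using P that t by auto
    ultimately show ?thesis
      by (simp add: R.m_comm)
  qed
  have ta: "t a \<in> carrier R"
    using t by auto
  have v1: "v \<beta> \<in> carrier M" "v (insert a \<beta>) \<in> carrier M" if "\<beta> \<subseteq> \<alpha>" for \<beta>
    using that by (auto intro!: v)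
  have P1: "P \<beta> \<in> carrier R" if "\<beta> \<subseteq> \<alpha>" for \<beta>
    using that by (auto intro!: P)
  have "cube_corner R M t v (insert a \<alpha>) =
      (\<Oplus>\<^bsub>M\<^esub>\<beta>\<in>Pow \<alpha>. P \<beta> \<odot>\<^bsub>M\<^esub> v \<beta>) \<oplus>\<^bsub>M\<^esub>
      (\<Oplus>\<^bsub>M\<^esub>\<beta>\<in>Pow \<alpha>. P (insert a \<beta>) \<odot>\<^bsub>M\<^esub> v (insert a \<beta>))"
    unfolding cube_corner_def P_def[symmetric]
    using fin a by (intro M.finsum_Pow_insert) (auto intro!: smult_closed P v)
  also have "\<dots> = (\<Oplus>\<^bsub>M\<^esub>\<beta>\<in>Pow \<alpha>.
      P \<beta> \<odot>\<^bsub>M\<^esub> v \<beta> \<oplus>\<^bsub>M\<^esub> P (insert a \<beta>) \<odot>\<^bsub>M\<^esub> v (insert a \<beta>))"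
    by (rule M.finsum_addf[symmetric]) (auto intro!: smult_closed P v)
  also have "\<dots> = (\<Oplus>\<^bsub>M\<^esub>\<beta>\<in>Pow \<alpha>. P \<beta> \<odot>\<^bsub>M\<^esub> (v \<beta> \<oplus>\<^bsub>M\<^esub> t a \<odot>\<^bsub>M\<^esub> v (insert a \<beta>)))"
    by (rule M.finsum_cong') (auto simp: Pins P1 v1 ta smult_r_distr smult_assoc1)
  finally show ?thesis
    unfolding cube_corner_def P_def .
qed

text \<open>A subset of \<alpha> never contains \<open>Suc n\<close>, so the corner at \<alpha>
  involves only entries that \<open>v\<close> shares with \<open>x\<close>. The second claim is
  \<open>cube_corner_insert\<close> with \<open>a = Suc n\<close>, the entries
  \<open>v (insert (Suc n) \<beta>)\<close> being those of \<open>y\<close>.\<close>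

lemma split_last_corners:
  assumes t: "t \<in> {1..Suc n} \<rightarrow> carrier R" and v: "v \<in> carrier (cube_module (Suc n) M)"
    and xy: "split_last n v = (x, y)" and \<alpha>: "\<alpha> \<subseteq> {1..n}"
  shows cube_corner_fst_split_last: "cube_corner R M t x \<alpha> = cube_corner R M t v \<alpha>"
    and cube_corner_add_split_last:
      "cube_corner R M t (x \<oplus>\<^bsub>cube_module n M\<^esub> t (Suc n) \<odot>\<^bsub>cube_module n M\<^esub> y) \<alpha> =
       cube_corner R M t v (insert (Suc n) \<alpha>)"
proof -
  have x: "x \<beta> = v \<beta>" and y: "y \<beta> = v (insert (Suc n) \<beta>)" if "\<beta> \<subseteq> {1..n}" for \<beta>
    using that xy by (auto simp: split_last_def)
  have fin: "finite \<alpha>"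
    using \<alpha> finite_subset by blast
  have vc: "v \<beta> \<in> carrier M" if "\<beta> \<subseteq> insert (Suc n) \<alpha>" for \<beta>
    by (rule cube_module_closed[OF v]) (use that \<alpha> in fastforce)
  have sub: "\<beta> \<subseteq> {1..n}" if "\<beta> \<subseteq> \<alpha>" for \<beta>
    using that \<alpha> by blast
  have t1: "t \<in> insert (Suc n) \<alpha> \<rightarrow> carrier R"
    using t \<alpha> by fastforce
  show "cube_corner R M t x \<alpha> = cube_corner R M t v \<alpha>"
    using fin t1 by (intro cube_corner_cong) (auto intro!: vc x sub)
  have "cube_corner R M t v (insert (Suc n) \<alpha>) =
      cube_corner R M t (\<lambda>\<beta>. v \<beta> \<oplus>\<^bsub>M\<^esub> t (Suc n) \<odot>\<^bsub>M\<^esub> v (insert (Suc n) \<beta>)) \<alpha>"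
    using fin t1 \<alpha> by (intro cube_corner_insert vc) auto
  also have "\<dots> =
      cube_corner R M t (x \<oplus>\<^bsub>cube_module n M\<^esub> t (Suc n) \<odot>\<^bsub>cube_module n M\<^esub> y) \<alpha>"
  proof (rule cube_corner_cong[symmetric])
    fix \<beta> assume \<beta>: "\<beta> \<subseteq> \<alpha>"
    show "v \<beta> \<oplus>\<^bsub>M\<^esub> t (Suc n) \<odot>\<^bsub>M\<^esub> v (insert (Suc n) \<beta>) \<in> carrier M"
      using \<beta> t1 by (intro M.a_closed smult_closed vc) auto
    show "(x \<oplus>\<^bsub>cube_module n M\<^esub> t (Suc n) \<odot>\<^bsub>cube_module n M\<^esub> y) \<beta> =
        v \<beta> \<oplus>\<^bsub>M\<^esub> t (Suc n) \<odot>\<^bsub>M\<^esub> v (insert (Suc n) \<beta>)"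
      using sub[OF \<beta>] x y by (auto simp: power_module_def)
  qed (use fin t1 in auto)
  finally show "cube_corner R M t (x \<oplus>\<^bsub>cube_module n M\<^esub> t (Suc n) \<odot>\<^bsub>cube_module n M\<^esub> y) \<alpha> =
      cube_corner R M t v (insert (Suc n) \<alpha>)" ..
qed

lemma cube_corner_zero:
  "v \<in> carrier (cube_module 0 M) \<Longrightarrow> cube_corner R M t v {} = v {}"
  using cube_module_closed[of v 0 M "{}"] by (simp add: cube_corner_def)

text \<open>Since \<open>f\<close> is only known to map \<open>U\<close> into
  \<open>carrier W\<close>, this is what makes the values of \<open>f\<close> at the corners
  summable in \<open>W\<close>. The two membership conditions in \<open>quot_dom\<close> settle the
  two cases \<open>Suc n \<notin> \<alpha>\<close> and \<open>Suc n \<in> \<alpha>\<close>.\<close>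

lemma cube_corner_in_dom:
  assumes "t \<in> {1..n} \<rightarrow> carrier R" "v \<in> iter_dom M U t n" "\<alpha> \<subseteq> {1..n}"
  shows "cube_corner R M t v \<alpha> \<in> U"
  using assms
proof (induction n arbitrary: v \<alpha>)
  case 0
  then show ?case
    by (simp add: cube_corner_zero)
next
  case (Suc n)
  obtain x y where xy: "split_last n v = (x, y)"
    by (cases "split_last n v")
  have v: "v \<in> carrier (cube_module (Suc n) M)"
    and x: "x \<in> iter_dom M U t n"
    and xty: "x \<oplus>\<^bsub>cube_module n M\<^esub> t (Suc n) \<odot>\<^bsub>cube_module n M\<^esub> y \<in> iter_dom M U t n"
    using Suc.prems(2) xy by (auto simp: quot_dom_def)
  have t: "t \<in> {1..n} \<rightarrow> carrier R"
    using Suc.prems(1) by auto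
  show ?case
  proof (cases "Suc n \<in> \<alpha>")
    case False
    then have \<alpha>: "\<alpha> \<subseteq> {1..n}"
      using Suc.prems(3) by (force simp: subset_iff le_Suc_eq)
    show ?thesis
      using Suc.IH[OF t x \<alpha>] cube_corner_fst_split_last[OF Suc.prems(1) v xy \<alpha>] by simp
  next
    case True
    then have \<alpha>: "\<alpha> - {Suc n} \<subseteq> {1..n}"
      using Suc.prems(3) by (force simp: subset_iff le_Suc_eq)
    \<comment> \<open>Here \<alpha> is written as
      \<open>insert (Suc n) (\<alpha> - {Suc n})\<close>.\<close>
    show ?thesis
      using Suc.IH[OF t xty \<alpha>] cube_corner_add_split_last[OF Suc.prems(1) v xy \<alpha>] True
      by (simp add: insert_absorb)
  qed
qed

section \<open>Alternating sums\<close>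

lemma finsum_uminus:
  assumes "g \<in> A \<rightarrow> carrier M"
  shows "(\<Oplus>\<^bsub>M\<^esub>a\<in>A. \<ominus>\<^bsub>M\<^esub> g a) = \<ominus>\<^bsub>M\<^esub> (\<Oplus>\<^bsub>M\<^esub>a\<in>A. g a)"
proof -
  have "(\<Oplus>\<^bsub>M\<^esub>a\<in>A. \<ominus>\<^bsub>M\<^esub> g a) \<oplus>\<^bsub>M\<^esub> (\<Oplus>\<^bsub>M\<^esub>a\<in>A. g a) = (\<Oplus>\<^bsub>M\<^esub>a\<in>A. \<ominus>\<^bsub>M\<^esub> g a \<oplus>\<^bsub>M\<^esub> g a)"
    using assms by (intro M.finsum_addf[symmetric]) auto
  also have "\<dots> = (\<Oplus>\<^bsub>M\<^esub>a\<in>A. \<zero>\<^bsub>M\<^esub>)"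
    using assms by (intro M.finsum_cong') (auto simp: M.l_neg Pi_iff)
  \<comment> \<open>The two sums add up to zero, so uniqueness of additive inverses applies.\<close>
  finally show ?thesis
    using assms by (intro M.minus_equality[symmetric] M.finsum_closed) (auto simp: Pi_iff)
qed

end

definition alternating_sum ::
  "('k, 'r) ring_scheme \<Rightarrow> ('k, 'w, 'n) module_scheme \<Rightarrow> nat \<Rightarrow> (nat set \<Rightarrow> 'w) \<Rightarrow> 'w" where
  "alternating_sum K W n g =
    (\<Oplus>\<^bsub>W\<^esub>\<alpha>\<in>Pow {1..n}. ((\<ominus>\<^bsub>K\<^esub> \<one>\<^bsub>K\<^esub>) [^]\<^bsub>K\<^esub> (n - card \<alpha>)) \<odot>\<^bsub>W\<^esub> g \<alpha>)"

context module
begin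

lemma alternating_sum_closed:
  "g \<in> Pow {1..n} \<rightarrow> carrier M \<Longrightarrow> alternating_sum R M n g \<in> carrier M"
  unfolding alternating_sum_def by (auto intro!: M.finsum_closed smult_closed)

lemma alternating_sum_cong:
  assumes "h \<in> Pow {1..n} \<rightarrow> carrier M" "\<And>\<alpha>. \<alpha> \<subseteq> {1..n} \<Longrightarrow> g \<alpha> = h \<alpha>"
  shows "alternating_sum R M n g = alternating_sum R M n h"
  unfolding alternating_sum_def using assms by (intro M.finsum_cong') (auto intro!: smult_closed)

text \<open>Passing from \<alpha> to \<open>insert (Suc n) \<alpha>\<close> while \<open>n\<close>
  grows by one leaves the exponent \<open>n - card \<alpha>\<close> unchanged. If \<alpha> is kept,
  the exponent grows by one and the sign flips.\<close>

lemma alternating_sum_Suc: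
  assumes g: "g \<in> Pow {1..Suc n} \<rightarrow> carrier M"
  shows "alternating_sum R M (Suc n) g =
    alternating_sum R M n (\<lambda>\<alpha>. g (insert (Suc n) \<alpha>)) \<ominus>\<^bsub>M\<^esub> alternating_sum R M n g"
proof -
  define s where "s k = (\<ominus> \<one>) [^] (k::nat)" for k
  have s: "s k \<in> carrier R" for k
    by (simp add: s_def)
  have s_Suc: "s (Suc k) = \<ominus> s k" for k
    using s[of k] by (simp add: s_def R.r_minus)
  \<comment> \<open>The bound by \<open>n\<close> prevents truncation:
    \<open>Suc n - card \<alpha>\<close> equals \<open>Suc (n - card \<alpha>)\<close>.\<close>
  have card: "card \<alpha> \<le> n" "card (insert (Suc n) \<alpha>) = Suc (card \<alpha>)" if "\<alpha> \<subseteq> {1..n}" for \<alpha>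
  proof -
    show "card \<alpha> \<le> n"
      using card_mono[OF _ that] by simp
    show "card (insert (Suc n) \<alpha>) = Suc (card \<alpha>)"
      using that finite_subset[OF that] by (intro card_insert_disjoint) auto
  qed
  have g1: "g \<alpha> \<in> carrier M" "g (insert (Suc n) \<alpha>) \<in> carrier M" if "\<alpha> \<subseteq> {1..n}" for \<alpha>
  proof -
    have "\<alpha> \<in> Pow {1..Suc n}" "insert (Suc n) \<alpha> \<in> Pow {1..Suc n}"
      using that by fastforce+
    then show "g \<alpha> \<in> carrier M" "g (insert (Suc n) \<alpha>) \<in> carrier M"
      using g by blast+
  qed
  have top: "{1..Suc n} = insert (Suc n) {1..n}"
    by auto
  have "alternating_sum R M (Suc n) g =
      (\<Oplus>\<^bsub>M\<^esub>\<alpha>\<in>Pow {1..n}. s (Suc n - card \<alpha>) \<odot>\<^bsub>M\<^esub> g \<alpha>) \<oplus>\<^bsub>M\<^esub>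
      (\<Oplus>\<^bsub>M\<^esub>\<alpha>\<in>Pow {1..n}. s (Suc n - card (insert (Suc n) \<alpha>)) \<odot>\<^bsub>M\<^esub> g (insert (Suc n) \<alpha>))"
    unfolding alternating_sum_def s_def[symmetric] top
    using g unfolding top by (intro M.finsum_Pow_insert) (auto intro!: smult_closed s)
  also have "(\<Oplus>\<^bsub>M\<^esub>\<alpha>\<in>Pow {1..n}. s (Suc n - card \<alpha>) \<odot>\<^bsub>M\<^esub> g \<alpha>) =
      (\<Oplus>\<^bsub>M\<^esub>\<alpha>\<in>Pow {1..n}. \<ominus>\<^bsub>M\<^esub> (s (n - card \<alpha>) \<odot>\<^bsub>M\<^esub> g \<alpha>))"
    by (rule M.finsum_cong')
      (auto simp: s s_Suc Suc_diff_le card g1 smult_l_minus intro!: M.a_inv_closed smult_closed)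
  also have "\<dots> = \<ominus>\<^bsub>M\<^esub> alternating_sum R M n g"
    unfolding alternating_sum_def s_def[symmetric]
    by (rule finsum_uminus) (auto intro!: smult_closed s g1)
  also have "(\<Oplus>\<^bsub>M\<^esub>\<alpha>\<in>Pow {1..n}. s (Suc n - card (insert (Suc n) \<alpha>)) \<odot>\<^bsub>M\<^esub> g (insert (Suc n) \<alpha>)) =
      alternating_sum R M n (\<lambda>\<alpha>. g (insert (Suc n) \<alpha>))"
    unfolding alternating_sum_def s_def[symmetric]
    by (rule M.finsum_cong') (auto simp: s card g1)
  finally show ?thesis
    using g1 by (simp add: M.a_comm a_minus_def alternating_sum_closed Pi_iff)
qed

end

section \<open>The formula for iterated difference quotients\<close>

lemma iter_map_eq_alternating_sum:
  assumes "module K V" "module K W" and f: "f \<in> U \<rightarrow> carrier W"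
    and "t \<in> {1..n} \<rightarrow> Units K" "v \<in> iter_dom V U t n"
  shows "iter_map K V W f t n v =
    inv\<^bsub>K\<^esub> (\<Otimes>\<^bsub>K\<^esub>i\<in>{1..n}. t i) \<odot>\<^bsub>W\<^esub>
      alternating_sum K W n (\<lambda>\<alpha>. f (cube_corner K V t v \<alpha>))"
proof -
  interpret V: module K V by fact
  interpret W: module K W by fact
  have closed: "(\<lambda>\<alpha>. f (cube_corner K V t v \<alpha>)) \<in> Pow {1..n} \<rightarrow> carrier W"
    if "t \<in> {1..n} \<rightarrow> Units K" "v \<in> iter_dom V U t n" for n v
    using that V.cube_corner_in_dom[of t n v U] f by (fastforce simp: Pi_iff)
  show ?thesis
    using assms(4,5)
  \<comment> \<open>The family \<open>v\<close> is generalized because the induction hypothesis is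
    applied to two other families, \<open>x\<close> and \<open>z\<close>.\<close>
  proof (induction n arbitrary: v)
    case 0
    then have "f (v {}) \<in> carrier W" "v \<in> carrier (cube_module 0 V)"
      using f by auto
    \<comment> \<open>Only the empty set is summed over, and both the inverted empty product and the
      sign are one. Membership of \<open>f (v {})\<close> in \<open>carrier W\<close> allows these
      scalars to be dropped.\<close>
    then show ?case
      by (simp add: alternating_sum_def V.cube_corner_zero)
  next
    case (Suc n)
    define P where "P = (\<Otimes>\<^bsub>K\<^esub>i\<in>{1..n}. t i)"
    define c where "c v = (\<lambda>\<alpha>. f (cube_corner K V t v \<alpha>))" for v
    obtain x y where xy: "split_last n v = (x, y)"
      by (cases "split_last n v")
    define z where "z = x \<oplus>\<^bsub>cube_module n V\<^esub> t (Suc n) \<odot>\<^bsub>cube_module n V\<^esub> y"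
    have v: "v \<in> carrier (cube_module (Suc n) V)"
      and x: "x \<in> iter_dom V U t n" and z: "z \<in> iter_dom V U t n"
      using Suc.prems(2) xy by (auto simp: quot_dom_def z_def)
    have tU: "t \<in> {1..n} \<rightarrow> Units K" and tS: "t (Suc n) \<in> Units K"
      and tK: "t \<in> {1..Suc n} \<rightarrow> carrier K"
      using Suc.prems(1) by auto
    have P: "P \<in> Units K"
      unfolding P_def using tU by (rule V.R.finprod_Units_closed)
    have prod: "(\<Otimes>\<^bsub>K\<^esub>i\<in>{1..Suc n}. t i) = t (Suc n) \<otimes>\<^bsub>K\<^esub> P"
      using tK by (auto simp: P_def atLeastAtMostSuc_conv Pi_iff)
    have inv: "inv\<^bsub>K\<^esub> (t (Suc n) \<otimes>\<^bsub>K\<^esub> P) = inv\<^bsub>K\<^esub> t (Suc n) \<otimes>\<^bsub>K\<^esub> inv\<^bsub>K\<^esub> P"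
      using tS P by (rule V.R.inv_mult_Units)
    \<comment> \<open>The congruence is used from right to left, since \<open>closed\<close> at
      level \<open>n\<close> provides membership for \<open>c x\<close>; likewise for
      \<open>c z\<close> below.\<close>
    have cx: "alternating_sum K W n (c x) = alternating_sum K W n (c v)"
      using closed[OF tU x] V.cube_corner_fst_split_last[OF tK v xy]
      by (intro W.alternating_sum_cong[symmetric]) (auto simp: c_def)
    have cz: "alternating_sum K W n (c z) =
        alternating_sum K W n (\<lambda>\<alpha>. c v (insert (Suc n) \<alpha>))"
      using closed[OF tU z] V.cube_corner_add_split_last[OF tK v xy]
      by (intro W.alternating_sum_cong[symmetric]) (auto simp: c_def z_def)
    have Ac: "alternating_sum K W n (c x) \<in> carrier W" "alternating_sum K W n (c z) \<in> carrier W"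
      unfolding c_def by (intro W.alternating_sum_closed closed[OF tU] x z)+
    have "iter_map K V W f t (Suc n) v = inv\<^bsub>K\<^esub> t (Suc n) \<odot>\<^bsub>W\<^esub>
        (inv\<^bsub>K\<^esub> P \<odot>\<^bsub>W\<^esub> alternating_sum K W n (c z) \<ominus>\<^bsub>W\<^esub>
         inv\<^bsub>K\<^esub> P \<odot>\<^bsub>W\<^esub> alternating_sum K W n (c x))"
      using Suc.IH[OF tU x] Suc.IH[OF tU z]
      by (simp add: quot_map_def xy z_def P_def c_def)
    \<comment> \<open>The induction hypotheses at \<open>x\<close> and \<open>z\<close> carry the
      same factor \<open>inv P\<close>, which is pulled out of the difference and merged with the
      inverse of \<open>t (Suc n)\<close>.\<close>
    also have "\<dots> = inv\<^bsub>K\<^esub> (t (Suc n) \<otimes>\<^bsub>K\<^esub> P) \<odot>\<^bsub>W\<^esub>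
        (alternating_sum K W n (c z) \<ominus>\<^bsub>W\<^esub> alternating_sum K W n (c x))"
      using P tS Ac
      by (simp add: inv a_minus_def W.smult_r_distr W.smult_r_minus W.smult_assoc1)
    also have "alternating_sum K W n (c z) \<ominus>\<^bsub>W\<^esub> alternating_sum K W n (c x) =
        alternating_sum K W (Suc n) (c v)"
      unfolding cx cz using closed[OF Suc.prems]
      by (intro W.alternating_sum_Suc[symmetric]) (simp add: c_def)
    finally show ?case
      unfolding prod c_def .
  qed
qed

theorem theorem2p3:
  fixes K :: "('k, 'r) ring_scheme"
    and V :: "('k, 'v, 'm) module_scheme"
    and W :: "('k, 'w, 'n) module_scheme"
    and U :: "'v set"
    and f :: "'v \<Rightarrow> 'w"
    and n :: nat
    and t :: "nat \<Rightarrow> 'k"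
    and v :: "nat set \<Rightarrow> 'v"
  assumes "cring K"
    and "module K V"
    and "module K W"
    and "U \<subseteq> carrier V"
    and "f \<in> U \<rightarrow> carrier W"
    and "n \<ge> 1"
    and "t \<in> {1..n} \<rightarrow> Units K"
    and "v \<in> iter_dom V U t n"
  shows "iter_map K V W f t n v =
    inv\<^bsub>K\<^esub> (\<Otimes>\<^bsub>K\<^esub>i\<in>{1..n}. t i) \<odot>\<^bsub>W\<^esub>
      (\<Oplus>\<^bsub>W\<^esub>\<alpha>\<in>Pow {1..n}.
        ((\<ominus>\<^bsub>K\<^esub> \<one>\<^bsub>K\<^esub>) [^]\<^bsub>K\<^esub> (n - card \<alpha>)) \<odot>\<^bsub>W\<^esub>
          f (\<Oplus>\<^bsub>V\<^esub>\<beta>\<in>Pow \<alpha>. (\<Otimes>\<^bsub>K\<^esub>i\<in>\<beta>. t i) \<odot>\<^bsub>V\<^esub> v \<beta>))"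
  using iter_map_eq_alternating_sum[OF assms(2,3,5,7,8)]
  unfolding alternating_sum_def cube_corner_def .

end
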